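(* For every $n\ge1$, the polynomial $\mathcal{A}_n(q,t):=\sum_{\sigma\in\mathcal{S}_n(231)}q^{\operatorname{maj}(\sigma)}t^{\binom{n}{2}-\operatorname{imaj}(\sigma)}$ and the $q,t$-Catalan number $\operatorname{Cat}_n(q,t):=\sum_{D\in\mathcal{D}_n}q^{\operatorname{area}(D)}t^{\operatorname{bounce}(D)}$ are related by $$\mathcal{A}_n(q,q^{-1})=\operatorname{Cat}_n(q,q^{-1}).$$
   Context: $\mathcal{S}_n$ is the symmetric group on $\{1,\dots,n\}$; $\mathcal{S}_n(231)$ is the set of $\sigma\in\mathcal{S}_n$ with no $i<j<k$ satisfying $\sigma_k<\sigma_i<\sigma_j$. The descent set is $\operatorname{Des}(\sigma)=\{i : 1\le i<n,\ \sigma_i>\sigma_{i+1}\}$, $\operatorname{maj}(\sigma)=\sum_{i\in\operatorname{Des}(\sigma)}i$, and $\operatorname{imaj}(\sigma)=\operatorname{maj}(\sigma^{-1})$. A Dyck path of semilength $n$ is a word with $n$ letters $0$ (north steps) and $n$ letters $1$ (east steps) such that every prefix contains at least as many $0$'s as $1$'s; $\mathcal{D}_n$ is the set of these. It is identified with a lattice path from $(0,0)$ to $(n,n)$ weakly above the diagonal $x=y$. For $D\in\mathcal{D}_n$ and $1\le y\le n$ let $a_y(D)$ be the number of $1$'s preceding the $y$-th $0$ of $D$ (so $0\le a_y(D)\le y-1$). Then $\operatorname{area}(D)=\sum_{y=1}^n(y-1-a_y(D))$, the number of full lattice squares between $D$ and the diagonal. The bounce statistic is defined by the bounce path which starts at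 $(n,n)$, goes west until it reaches the top of a north step of $D$, then goes south to the diagonal, then again west until the top of a north step of $D$, south to the diagonal, and so on until $(0,0)$; $\operatorname{bounce}(D)$ is the sum of the values $j$ over the points $(j,j)$ with $0<j<n$ at which the bounce path meets the diagonal after a south run. Equivalently: set $j_0=n$ and $j_{i+1}=a_{j_i}(D)$ as long as $j_i>0$; then $\operatorname{bounce}(D)=\sum_{i\ge1}j_i$. *)

theory Defs
  imports
    "HOL-Combinatorics.Permutations"
    "HOL-Computational_Algebra.Formal_Laurent_Series"
begin

section \<open>Permutations avoiding 231\<close>

definition avoids_231 :: "nat \<Rightarrow> (nat \<Rightarrow> nat) \<Rightarrow> bool" where
  "avoids_231 n \<sigma> \<longleftrightarrow>
     \<not> (\<exists>i j k. 1 \<le> i \<and> i < j \<and> j < k \<and> k \<le> n \<and> \<sigma> k < \<sigma> i \<and> \<sigma> i < \<sigma> j)"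

definition S_231 :: "nat \<Rightarrow> (nat \<Rightarrow> nat) set" where
  "S_231 n = {\<sigma>. \<sigma> permutes {1..n} \<and> avoids_231 n \<sigma>}"

definition Des :: "nat \<Rightarrow> (nat \<Rightarrow> nat) \<Rightarrow> nat set" where
  "Des n \<sigma> = {i. 1 \<le> i \<and> i < n \<and> \<sigma> i > \<sigma> (i + 1)}"

definition maj :: "nat \<Rightarrow> (nat \<Rightarrow> nat) \<Rightarrow> nat" where
  "maj n \<sigma> = \<Sum> (Des n \<sigma>)"

definition imaj :: "nat \<Rightarrow> (nat \<Rightarrow> nat) \<Rightarrow> nat" where
  "imaj n \<sigma> = maj n (inv \<sigma>)"


section \<open>Dyck paths\<close>

text \<open>The letters 0 and 1 of the words are rendered as North and East.\<close>

datatype step = North | East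

definition Dyck :: "nat \<Rightarrow> step list set" where
  "Dyck n = {D. count_list D North = n \<and> count_list D East = n \<and>
     (\<forall>k\<le>length D. count_list (take k D) East \<le> count_list (take k D) North)}"

text \<open>The position, counted from 0, of the \<open>y\<close>-th north step, where \<open>y\<close> is counted from 1.\<close>

definition north_pos :: "step list \<Rightarrow> nat \<Rightarrow> nat" where
  "north_pos D y = filter (\<lambda>i. D ! i = North) [0..<length D] ! (y - 1)"

definition easts_before :: "step list \<Rightarrow> nat \<Rightarrow> nat" where
  "easts_before D y = count_list (take (north_pos D y) D) East"

text \<open>For a Dyck path, \<open>easts_before D y \<le> y - 1\<close>, so the subtraction does not truncate.\<close>

definition area :: "nat \<Rightarrow> step list \<Rightarrow> nat" where
  "area n D = (\<Sum>y = 1..n. y - 1 - easts_before D y)"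

text \<open>
  The successive points where the bounce path meets the diagonal, starting at \<open>(n, n)\<close>:
  from \<open>(j, j)\<close> it goes west to the top \<open>(easts_before D j, j)\<close> of the \<open>j\<close>-th north step, then
  south to the diagonal.  After reaching the origin the sequence is continued by 0.
\<close>

primrec bounce_point :: "nat \<Rightarrow> step list \<Rightarrow> nat \<Rightarrow> nat" where
  "bounce_point n D 0 = n"
| "bounce_point n D (Suc i) =
     (if bounce_point n D i = 0 then 0 else easts_before D (bounce_point n D i))"

text \<open>
  For a Dyck path the sequence decreases strictly until it is 0, so the terms with
  index above \<open>n\<close> vanish.
\<close>

definition bounce :: "nat \<Rightarrow> step list \<Rightarrow> nat" where
  "bounce n D = (\<Sum>i = 1..n. bounce_point n D i)"


section \<open>The two bivariate polynomials\<close>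

text \<open>
  \<open>int poly poly\<close> is read as polynomials in \<open>t\<close> with coefficients in \<open>\<int>[q]\<close>.
\<close>

definition qt_monom :: "nat \<Rightarrow> nat \<Rightarrow> int poly poly" where
  "qt_monom a b = monom (monom 1 a) b"

definition qt_eval :: "int poly poly \<Rightarrow> 'a::comm_ring_1 \<Rightarrow> 'a \<Rightarrow> 'a" where
  "qt_eval P q t = poly (map_poly (\<lambda>p. poly (map_poly of_int p) q) P) t"

text \<open>The exponent of \<open>t\<close> does not truncate: \<open>imaj n \<sigma> \<le> 1 + \<dots> + (n - 1) = n choose 2\<close>.\<close>

definition A_poly :: "nat \<Rightarrow> int poly poly" where
  "A_poly n = (\<Sum>\<sigma>\<in>S_231 n. qt_monom (maj n \<sigma>) ((n choose 2) - imaj n \<sigma>))"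

definition Cat_poly :: "nat \<Rightarrow> int poly poly" where
  "Cat_poly n = (\<Sum>D\<in>Dyck n. qt_monom (area n D) (bounce n D))"

end

theory Submission
  imports Defs
begin

text \<open>
  Write \<open>G(i, j)\<close> for the Gaussian binomial coefficient \<open>[i + j choose j]\<close>.  Both sides turn out to be
  \<open>q\<^bsup>-N\<^esup>\<close> times MacMahon's \<open>q\<close>-Catalan number \<open>G(n, n) - q G(n + 1, n - 1)\<close>, with
  \<open>N = n choose 2\<close>.  The common model is the set \<open>dyck_seqs n\<close> of sequences
  \<open>a\<^sub>1 \<le> \<dots> \<le> a\<^sub>n\<close> with \<open>a\<^sub>y \<le> y - 1\<close>.

  On the path side, \<open>a\<^sub>y\<close> is the number of east steps before the \<open>y\<close>-th north step
  (\<open>bij_betw_profile\<close>).  With \<open>m = a\<^sub>n\<close>, the first bounce goes to \<open>(m, m)\<close>, the initial part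
  \<open>a\<^sub>1, \<dots>, a\<^sub>m\<close> is an arbitrary sequence of the same kind, and the entries between it and \<open>a\<^sub>n\<close>
  fill a box freely (\<open>dyck_seqs_first_bounce\<close>).  At \<open>t = 1/q\<close> this gives a recurrence for the
  generating function refined by \<open>n - a\<^sub>n\<close>, which the \<open>q\<close>-Vandermonde identity solves
  (\<open>qballot_recurrence\<close>, \<open>sum_weight\<close>).

  On the permutation side, \<open>a\<^sub>y = min {\<sigma>\<^sub>y, \<dots>, \<sigma>\<^sub>n} - 1\<close> defines a bijection from the
  231-avoiding permutations (\<open>bij_betw_perm_seq\<close>): the values are recovered one by one, as
  \<open>v\<close> must stand at the last free position \<open>y\<close> with \<open>a\<^sub>y < v\<close>.  Here \<open>i\<close> is a descent of \<open>\<sigma>\<close> iff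
  \<open>a\<^sub>i = a\<^bsub>i+1\<^esub>\<close>, and \<open>j\<close> is a descent of the inverse iff \<open>j\<close> is not among the \<open>a\<^sub>y\<close>.  Hence
  \<open>maj + imaj = 2N - M\<close>, where \<open>M\<close> is the major index of the corresponding Dyck path
  (\<open>maj_imaj_valley_maj\<close>).  The distribution of \<open>M\<close> is MacMahon's (\<open>sum_valley_maj\<close>), and the
  symmetry \<open>q \<mapsto> 1/q\<close> of the \<open>q\<close>-Catalan number (\<open>qballot_inverse\<close>) matches the two sides.
\<close>

section \<open>Gaussian binomial coefficients\<close>

text \<open>
  The Gaussian binomial coefficient \<open>[i + j choose j]\<close> at \<open>q\<close>.  Indexing by the two sides of the
  box makes it total without conventions for indices out of range.
\<close>
fun gauss :: "'a::comm_ring_1 \<Rightarrow> nat \<Rightarrow> nat \<Rightarrow> 'a" where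
  "gauss q 0 j = 1"
| "gauss q (Suc i) 0 = 1"
| "gauss q (Suc i) (Suc j) = gauss q (Suc i) j + q ^ Suc j * gauss q i (Suc j)"

lemma gauss_0_right [simp]: "gauss q i 0 = 1"
  by (cases i) simp_all

lemma gauss_ratio:
  "(1 - q ^ Suc i) * gauss q (Suc i) j = (1 - q ^ Suc j) * gauss q i (Suc j)"
proof (induction i arbitrary: j)
  case 0
  show ?case
  proof (induction j)
    case (Suc j)
    have "(1 - q ^ Suc 0) * gauss q (Suc 0) (Suc j)
        = (1 - q ^ Suc 0) * gauss q (Suc 0) j + (1 - q ^ Suc 0) * q ^ Suc j"
      by (simp add: algebra_simps)
    also have "\<dots> = (1 - q ^ Suc (Suc j)) * gauss q 0 (Suc (Suc j))"
      unfolding Suc.IH by (simp add: algebra_simps)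
    finally show ?case .
  qed simp
next
  case (Suc i)
  note outer = Suc.IH
  show ?case
  proof (induction j)
    case 0
    show ?case using outer[of 0] by (simp add: algebra_simps)
  next
    case (Suc j)
    let ?A = "gauss q (Suc i) (Suc j)"
    have "(1 - q ^ Suc (Suc i)) * gauss q (Suc (Suc i)) (Suc j)
        = (1 - q ^ Suc (Suc i)) * gauss q (Suc (Suc i)) j
          + q ^ Suc j * (1 - q ^ Suc (Suc i)) * ?A"
      by (simp only: gauss.simps) (simp add: algebra_simps)
    also have "\<dots> = (1 - q ^ (i + j + 3)) * ?A"
      unfolding Suc.IH by (simp add: algebra_simps power_add eval_nat_numeral)
    also have "\<dots> = (1 - q ^ Suc (Suc j)) * ?A
        + q ^ Suc (Suc j) * ((1 - q ^ Suc i) * ?A)"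
      by (simp add: algebra_simps power_add eval_nat_numeral)
    also have "\<dots> = (1 - q ^ Suc (Suc j)) * gauss q (Suc i) (Suc (Suc j))"
      unfolding outer by (simp only: gauss.simps) (simp add: algebra_simps)
    finally show ?case .
  qed
qed

lemma gauss_pascal:
  "gauss q (Suc i) (Suc j) = q ^ Suc i * gauss q (Suc i) j + gauss q i (Suc j)"
  using gauss_ratio[of q i j] by (simp add: algebra_simps)

lemma gauss_sym: "gauss q i j = gauss q j i"
proof (induction i arbitrary: j)
  case 0
  show ?case by simp
next
  case (Suc i)
  note outer = Suc.IH
  show ?case
  proof (induction j)
    case (Suc j)
    show ?case
      using Suc.IH outer[of "Suc j"] gauss_pascal[of q j i] by (simp add: algebra_simps)
  qed simp
qed

text \<open>
  This and \<open>gauss_ratio\<close> are division-free forms of the product formula; they hold in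
  every commutative ring.
\<close>
lemma gauss_absorb:
  "(1 - q ^ Suc j) * gauss q i (Suc j) = (1 - q ^ Suc (i + j)) * gauss q i j"
proof (cases i)
  case (Suc k)
  have "(1 - q ^ Suc j) * gauss q i (Suc j)
      = (1 - q ^ Suc j) * gauss q i j + q ^ Suc j * ((1 - q ^ Suc j) * gauss q k (Suc j))"
    unfolding Suc by (simp only: gauss.simps) (simp add: algebra_simps)
  also have "\<dots> = (1 - q ^ Suc (i + j)) * gauss q i j"
    unfolding gauss_ratio[symmetric] Suc by (simp add: algebra_simps power_add)
  finally show ?thesis .
qed simp

lemma gauss_three_term:
  "gauss q (Suc i) (Suc j)
     = gauss q (Suc i) j + gauss q i (Suc j) - (1 - q ^ Suc (i + j)) * gauss q i j"
  unfolding gauss_absorb[symmetric] by (simp add: algebra_simps)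

lemma gauss_inverse:
  assumes "q * p = (1::'a::comm_ring_1)"
  shows "q ^ (i * j) * gauss p i j = gauss q i j"
proof (induction i arbitrary: j)
  case 0
  show ?case by simp
next
  case (Suc i)
  note outer = Suc.IH
  have qp: "q ^ k * p ^ k = 1" for k
    using assms by (simp flip: power_mult_distrib)
  show ?case
  proof (induction j)
    case (Suc j)
    have "q ^ (Suc i * Suc j) * gauss p (Suc i) (Suc j)
        = q ^ Suc i * (q ^ (Suc i * j) * gauss p (Suc i) j)
          + (q ^ Suc j * p ^ Suc j) * (q ^ (i * Suc j) * gauss p i (Suc j))"
      by (simp only: gauss.simps) (simp add: algebra_simps power_add)
    also have "\<dots> = gauss q (Suc i) (Suc j)"
      unfolding Suc.IH outer qp gauss_pascal by simp
    finally show ?case .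
  qed simp
qed

lemma gauss_vandermonde:
  "(\<Sum>r\<le>m. gauss q k r * gauss q l (m - r) * q ^ (r * Suc l)) = gauss q (Suc (k + l)) m"
proof (induction k arbitrary: m)
  case 0
  show ?case
  proof (induction m)
    case (Suc m)
    have "(\<Sum>r\<le>Suc m. gauss q 0 r * gauss q l (Suc m - r) * q ^ (r * Suc l))
      = gauss q l (Suc m)
        + q ^ Suc l * (\<Sum>r\<le>m. gauss q 0 r * gauss q l (m - r) * q ^ (r * Suc l))"
      unfolding sum_distrib_left
      by (subst sum.atMost_Suc_shift) (simp add: power_add mult_ac)
    then show ?case
      unfolding Suc.IH using gauss_pascal[of q l m] by simp
  qed simp
next
  case (Suc k)
  note outer = Suc.IH
  show ?case
  proof (induction m)
    case (Suc m)
    have "(\<Sum>r\<le>Suc m. gauss q (Suc k) r * gauss q l (Suc m - r) * q ^ (r * Suc l))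
      = gauss q l (Suc m) +
        (\<Sum>r\<le>m. gauss q (Suc k) (Suc r) * gauss q l (m - r) * q ^ (Suc r * Suc l))"
      by (subst sum.atMost_Suc_shift) simp
    also have "(\<Sum>r\<le>m. gauss q (Suc k) (Suc r) * gauss q l (m - r) * q ^ (Suc r * Suc l))
      = q ^ (k + l + 2) * (\<Sum>r\<le>m. gauss q (Suc k) r * gauss q l (m - r) * q ^ (r * Suc l))
        + (\<Sum>r\<le>m. gauss q k (Suc r) * gauss q l (m - r) * q ^ (Suc r * Suc l))"
      unfolding gauss_pascal sum_distrib_left sum.distrib[symmetric]
      by (rule sum.cong) (simp_all add: algebra_simps power_add power2_eq_square)
    also have "(\<Sum>r\<le>m. gauss q (Suc k) r * gauss q l (m - r) * q ^ (r * Suc l))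
      = gauss q (Suc (Suc k + l)) m" by (rule Suc.IH)
    also have "gauss q l (Suc m) + (q ^ (k + l + 2) * gauss q (Suc (Suc k + l)) m
        + (\<Sum>r\<le>m. gauss q k (Suc r) * gauss q l (m - r) * q ^ (Suc r * Suc l)))
      = q ^ (k + l + 2) * gauss q (Suc (Suc k + l)) m
        + (\<Sum>r\<le>Suc m. gauss q k r * gauss q l (Suc m - r) * q ^ (r * Suc l))"
      by (subst sum.atMost_Suc_shift) (simp del: gauss.simps)
    also have "\<dots> = gauss q (Suc (Suc k + l)) (Suc m)"
      unfolding outer using gauss_pascal[of q "Suc (k + l)" m] by simp
    finally show ?case .
  qed simp
qed

text \<open>
  A \<open>q\<close>-ballot number, equal to \<open>[2m + k choose m] [k + 1] / [m + k + 1]\<close> when the quotient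
  makes sense.  For \<open>k = 0\<close> it is the \<open>q\<close>-Catalan number.
\<close>
definition qballot :: "'a::comm_ring_1 \<Rightarrow> nat \<Rightarrow> nat \<Rightarrow> 'a" where
  "qballot q m k = gauss q (m + k) m - (if m = 0 then 0 else q ^ Suc k * gauss q (Suc (m + k)) (m - 1))"

lemma qballot_shift:
  assumes "m > 0"
  shows "q ^ m * qballot q m k = gauss q (m + k) m - gauss q (Suc (m + k)) (m - 1)"
proof -
  obtain m' where m: "m = Suc m'" using assms by (cases m) auto
  show ?thesis
    using gauss_ratio[of q "m + k" m'] unfolding m qballot_def
    by (simp add: algebra_simps power_add del: gauss.simps)
qed

text \<open>
  The recurrence produced by the bounce decomposition.  Multiplied by \<open>q\<^sup>m\<close>, the sum over
  \<open>0 \<le> r \<le> m\<close> becomes a difference of two \<open>q\<close>-Vandermonde convolutions.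
\<close>
lemma qballot_recurrence:
  assumes inv: "q * p = (1::'a::comm_ring_1)" and "m > 0"
  shows "(\<Sum>r=1..m. gauss q k r * (q ^ ((r - 1) * m) * qballot q (m - r) (r - 1))) = qballot q m k"
    (is "?S = _")
proof -
  obtain m' where m: "m = Suc m'" using assms by (cases m) auto
  let ?f = "\<lambda>r. gauss q k r * gauss q m' (m - r) * q ^ (r * m)"
  let ?g = "\<lambda>r. gauss q k r * gauss q m (m' - r) * q ^ (r * Suc m)"
  have "q ^ m * ?S = (\<Sum>r=1..m. ?f r - (if r = m then 0 else ?g r))"
    unfolding sum_distrib_left
  proof (rule sum.cong)
    fix r assume r: "r \<in> {1..m}"
    then obtain s where s: "r = Suc s" by (cases r) auto
    have 1: "m - r + (r - 1) = m'" "Suc (m - r + (r - 1)) = m" "m - r - 1 = m' - r" "m - r = 0 \<longleftrightarrow> r = m" "Suc (r - 1) = r"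
      using r m by auto
    have 2: "q ^ m * q ^ ((r - 1) * m) = q ^ (r * m)"
      unfolding s by (simp add: power_add)
    have 3: "q ^ (r * m) * q ^ r = q ^ (r * Suc m)"
      by (simp add: power_add)
    have "qballot q (m - r) (r - 1)
        = gauss q m' (m - r) - (if r = m then 0 else q ^ r * gauss q m (m' - r))"
      unfolding qballot_def 1 by (simp add: m[symmetric])
    then have "q ^ m * (gauss q k r * (q ^ ((r - 1) * m) * qballot q (m - r) (r - 1)))
       = gauss q k r * q ^ (r * m) * (gauss q m' (m - r) - (if r = m then 0 else q ^ r * gauss q m (m' - r)))"
      unfolding 2[symmetric] by (simp add: mult_ac)
    also have "\<dots> = ?f r - (if r = m then 0 else ?g r)"
      unfolding 3[symmetric] by (simp add: algebra_simps del: mult_Suc_right)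
    finally show "q ^ m * (gauss q k r * (q ^ ((r - 1) * m) * qballot q (m - r) (r - 1)))
       = ?f r - (if r = m then 0 else ?g r)" .
  qed simp
  also have "\<dots> = (\<Sum>r=1..m. ?f r) - (\<Sum>r=1..m'. ?g r)"
    unfolding sum_subtractf m by (simp add: sum.cl_ivl_Suc)
  \<comment> \<open>The two terms with index 0 cancel.\<close>
  also have "\<dots> = (\<Sum>r\<le>m. ?f r) - (\<Sum>r\<le>m'. ?g r)"
  proof -
    have "(\<Sum>r\<le>N. h r) = h 0 + (\<Sum>r=1..N. h r)" for N and h :: "nat \<Rightarrow> 'a"
      by (simp add: atMost_atLeast0 sum.atLeast_Suc_atMost)
    moreover have "?f 0 = ?g 0" unfolding m using gauss_sym[of q m' "Suc m'"] by simp
    ultimately show ?thesis by simp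
  qed
  also have "\<dots> = gauss q (m + k) m - gauss q (Suc (m + k)) (m - 1)"
    using gauss_vandermonde[where q = q and k = k and l = m' and m = m]
      gauss_vandermonde[where q = q and k = k and l = m and m = m']
    unfolding m by (simp add: add_ac del: gauss.simps)
  also have "\<dots> = q ^ m * qballot q m k" by (rule qballot_shift[OF \<open>m > 0\<close>, symmetric])
  finally have "p ^ m * q ^ m * ?S = p ^ m * q ^ m * qballot q m k" by (simp add: mult.assoc)
  then show ?thesis using inv by (simp add: mult.commute flip: power_mult_distrib)
qed

lemma qballot_inverse:
  assumes inv: "q * p = (1::'a::comm_ring_1)"
  shows "q ^ (n * (n - 1)) * qballot p n 0 = qballot q n 0"
proof (cases n)
  case 0
  then show ?thesis by (simp add: qballot_def)
next
  case (Suc m)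
  have pq: "p * q = 1" using inv by (simp add: mult.commute)
  have "q ^ n * (q ^ (n * (n - 1)) * qballot p n 0)
      = q ^ (n * n) * gauss p n n - (q * p) * (q ^ (Suc n * m) * gauss p (Suc n) m)"
    unfolding qballot_def Suc by (simp add: algebra_simps power_add del: gauss.simps)
  also have "\<dots> = gauss q n n - gauss q (Suc n) m"
    unfolding gauss_inverse[OF inv] inv by simp
  also have "\<dots> = q ^ n * qballot q n 0" using qballot_shift[of n q 0] Suc by simp
  finally have "p ^ n * q ^ n * (q ^ (n * (n - 1)) * qballot p n 0) = p ^ n * q ^ n * qballot q n 0"
    by (simp add: mult.assoc)
  then show ?thesis using pq by (simp flip: power_mult_distrib)
qed

section \<open>Nondecreasing sequences below the diagonal\<close>

text \<open>
  The first entry of a sequence, with value 0 for the empty one.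
\<close>
fun head0 :: "nat list \<Rightarrow> nat" where
  "head0 [] = 0"
| "head0 (x # c) = x"

text \<open>
  The sequences \<open>a\<^sub>1 \<le> \<dots> \<le> a\<^sub>n\<close> with \<open>a\<^sub>y \<le> y - 1\<close>, listed backwards from \<open>a\<^sub>n\<close> to \<open>a\<^sub>1\<close>, so that
  adding the last row of a path is a \<open>Cons\<close>.
\<close>
primrec dyck_seqs :: "nat \<Rightarrow> nat list set" where
  "dyck_seqs 0 = {[]}"
| "dyck_seqs (Suc n) = {x # c |x c. c \<in> dyck_seqs n \<and> head0 c \<le> x \<and> x \<le> n}"

lemma finite_dyck_seqs [simp]: "finite (dyck_seqs n)"
proof (induction n)
  case (Suc n)
  have "dyck_seqs (Suc n) \<subseteq> (\<lambda>(x, c). x # c) ` ({..n} \<times> dyck_seqs n)" by auto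
  then show ?case by (rule finite_subset) (use Suc in simp)
qed simp

lemma length_dyck_seqs: "c \<in> dyck_seqs n \<Longrightarrow> length c = n"
  by (induction n arbitrary: c) auto

lemma head0_dyck_seqs: "c \<in> dyck_seqs (Suc n) \<Longrightarrow> head0 c \<le> n"
  by auto

lemma dyck_seqs_iff:
  "c \<in> dyck_seqs n \<longleftrightarrow> length c = n \<and> sorted (rev c) \<and> (\<forall>i<n. rev c ! i \<le> i)"
proof (induction n arbitrary: c)
  case 0
  show ?case by auto
next
  case (Suc n)
  show ?case
  proof (cases c)
    case Nil
    then show ?thesis by simp
  next
    case (Cons x d)
    have max: "(\<forall>y\<in>set d. y \<le> x) \<longleftrightarrow> head0 d \<le> x" if "sorted (rev d)"
      using that by (cases d) (auto simp: sorted_append intro: order_trans)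
    have nth: "(\<forall>i<Suc n. rev c ! i \<le> i) \<longleftrightarrow> (\<forall>i<n. rev d ! i \<le> i) \<and> x \<le> n"
      if "length d = n"
      using that unfolding Cons All_less_Suc by (simp add: nth_append conj_commute)
    have "c \<in> dyck_seqs (Suc n) \<longleftrightarrow> d \<in> dyck_seqs n \<and> head0 d \<le> x \<and> x \<le> n"
      unfolding Cons by simp
    also have "\<dots> \<longleftrightarrow> length c = Suc n \<and> sorted (rev c) \<and> (\<forall>i<Suc n. rev c ! i \<le> i)"
      unfolding Suc.IH using max nth by (auto simp: Cons sorted_append)
    finally show ?thesis .
  qed
qed

section \<open>The major index of Dyck paths\<close>

text \<open>
  The major index of the lattice path: a valley occurs where \<open>a\<^sub>i < a\<^bsub>i+1\<^esub>\<close>, after \<open>i\<close> north and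
  \<open>a\<^bsub>i+1\<^esub>\<close> east steps.
\<close>
primrec valley_maj :: "nat list \<Rightarrow> nat" where
  "valley_maj [] = 0"
| "valley_maj (x # c) = valley_maj c + (if head0 c < x then length c + x else 0)"

text \<open>
  MacMahon's theorem for ballot paths with \<open>i\<close> north and \<open>j\<close> east steps: both sides satisfy the
  same three-term recurrence off the diagonal, and each takes equal values at \<open>(i, i)\<close> and
  \<open>(i, i - 1)\<close>.
\<close>
lemma sum_valley_maj_bounded:
  fixes q :: "'a::comm_ring_1"
  assumes "j \<le> i"
  shows "(\<Sum>c\<in>{c \<in> dyck_seqs i. head0 c \<le> j}. q ^ valley_maj c)
       = gauss q i j - (if j = 0 then 0 else q * gauss q (Suc i) (j - 1))"
proof -
  define W where "W i j = (\<Sum>c\<in>{c \<in> dyck_seqs i. head0 c \<le> j}. q ^ valley_maj c)" for i j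
  define V where "V i j = gauss q i j - (if j = 0 then 0 else q * gauss q (Suc i) (j - 1))" for i j
  have split: "W i (Suc j) = W i j + (\<Sum>c\<in>{c \<in> dyck_seqs i. head0 c = Suc j}. q ^ valley_maj c)" for i j
  proof -
    have "{c \<in> dyck_seqs i. head0 c \<le> Suc j} = {c \<in> dyck_seqs i. head0 c \<le> j} \<union> {c \<in> dyck_seqs i. head0 c = Suc j}"
      by auto
    then show ?thesis unfolding W_def by (simp add: sum.union_disjoint disjoint_iff)
  qed
  have rec: "W (Suc i) (Suc j) = W (Suc i) j + W i (Suc j) - (1 - q ^ Suc (i + j)) * W i j"
    if "j < i" for i j
  proof -
    have "{c \<in> dyck_seqs (Suc i). head0 c = Suc j} = (#) (Suc j) ` {c \<in> dyck_seqs i. head0 c \<le> Suc j}"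
      using that by auto
    then have "(\<Sum>c\<in>{c \<in> dyck_seqs (Suc i). head0 c = Suc j}. q ^ valley_maj c)
        = (\<Sum>c\<in>{c \<in> dyck_seqs i. head0 c \<le> Suc j}. q ^ valley_maj (Suc j # c))"
      by (simp add: sum.reindex)
    also have "{c \<in> dyck_seqs i. head0 c \<le> Suc j} = {c \<in> dyck_seqs i. head0 c \<le> j} \<union> {c \<in> dyck_seqs i. head0 c = Suc j}"
      by auto
    also have "(\<Sum>c\<in>\<dots>. q ^ valley_maj (Suc j # c))
        = (\<Sum>c\<in>{c \<in> dyck_seqs i. head0 c \<le> j}. q ^ valley_maj (Suc j # c))
          + (\<Sum>c\<in>{c \<in> dyck_seqs i. head0 c = Suc j}. q ^ valley_maj (Suc j # c))"
      by (simp add: sum.union_disjoint disjoint_iff del: valley_maj.simps)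
    also have "(\<Sum>c\<in>{c \<in> dyck_seqs i. head0 c \<le> j}. q ^ valley_maj (Suc j # c)) = q ^ Suc (i + j) * W i j"
      unfolding W_def sum_distrib_left
      by (rule sum.cong) (auto simp: length_dyck_seqs power_add)
    also have "(\<Sum>c\<in>{c \<in> dyck_seqs i. head0 c = Suc j}. q ^ valley_maj (Suc j # c)) = W i (Suc j) - W i j"
      unfolding split by simp
    finally show ?thesis unfolding split[of "Suc i"] by (simp add: algebra_simps)
  qed
  have diag: "W (Suc i) (Suc i) = W (Suc i) i" for i
    unfolding W_def using head0_dyck_seqs le_SucI by (intro sum.cong) blast+
  have W0: "W i 0 = 1" for i
  proof (induction i)
    case 0
    have "{c \<in> dyck_seqs 0. head0 c \<le> 0} = {[]}" by auto
    then show ?case by (simp add: W_def)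
  next
    case (Suc i)
    have "{c \<in> dyck_seqs (Suc i). head0 c \<le> 0} = (#) 0 ` {c \<in> dyck_seqs i. head0 c \<le> 0}"
      by auto
    then have "W (Suc i) 0 = W i 0" by (simp add: W_def sum.reindex)
    then show ?case using Suc by simp
  qed
  have V0: "V i 0 = 1" for i by (simp add: V_def)
  have recV: "V (Suc i) (Suc j) = V (Suc i) j + V i (Suc j) - (1 - q ^ Suc (i + j)) * V i j" for i j
  proof (cases j)
    case 0
    show ?thesis using gauss_three_term[of q i 0] unfolding 0 V_def by (simp del: gauss.simps)
  next
    case (Suc k)
    show ?thesis
      unfolding Suc V_def diff_Suc_1 gauss_three_term[of q i "Suc k"] gauss_three_term[of q "Suc i" k]
      by (simp add: algebra_simps del: gauss.simps)
  qed
  have diagV: "V (Suc i) (Suc i) = V (Suc i) i" for i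
  proof (cases i)
    case (Suc k)
    show ?thesis
      using gauss_pascal[of q "Suc k" "Suc k"] gauss.simps(3)[of q "Suc (Suc k)" k]
        gauss.simps(3)[of q "Suc k" "Suc k"] gauss_sym[of q "Suc (Suc k)" "Suc k"]
      unfolding Suc V_def by (simp add: algebra_simps del: gauss.simps)
  qed (simp add: V_def)
  have "j \<le> i \<Longrightarrow> W i j = V i j"
  proof (induction i arbitrary: j)
    case 0
    then show ?case by (simp add: W0 V0)
  next
    case (Suc i)
    note outer = Suc.IH
    from Suc.prems show ?case
    proof (induction j)
      case 0
      show ?case by (simp add: W0 V0)
    next
      case (Suc j)
      then show ?case
        by (cases "j = i") (simp_all add: diag diagV rec recV outer)
    qed
  qed
  then show ?thesis using assms by (simp add: W_def V_def)
qed

lemma sum_valley_maj: "(\<Sum>c\<in>dyck_seqs n. q ^ valley_maj c) = qballot q n 0"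
proof -
  have "{c \<in> dyck_seqs n. head0 c \<le> n} = dyck_seqs n"
    using head0_dyck_seqs by (cases n) fastforce+
  then show ?thesis using sum_valley_maj_bounded[of n n q] by (simp add: qballot_def)
qed

section \<open>Area and bounce of sequences\<close>

text \<open>
  The area and the bounce statistic of a path in terms of its sequence.  In \<open>bounce_seq\<close> the part
  dropped consists of the rows that the bounce path passes before it meets the diagonal at \<open>(x, x)\<close>.
\<close>
primrec area_seq :: "nat list \<Rightarrow> nat" where
  "area_seq [] = 0"
| "area_seq (x # c) = area_seq c + (length c - x)"

fun bounce_seq :: "nat list \<Rightarrow> nat" where
  "bounce_seq [] = 0"
| "bounce_seq (x # c) = x + bounce_seq (drop (length c - x) c)"

text \<open>
  The nonincreasing sequences of length \<open>k\<close> with entries between \<open>l\<close> and \<open>h\<close>: partitions in a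
  box of size \<open>k \<times> (h - l)\<close>.
\<close>
primrec box_seqs :: "nat \<Rightarrow> nat \<Rightarrow> nat \<Rightarrow> nat list set" where
  "box_seqs l 0 h = {[]}"
| "box_seqs l (Suc k) h = {x # c |x c. l \<le> x \<and> x \<le> h \<and> c \<in> box_seqs l k x}"

lemma finite_box_seqs [simp]: "finite (box_seqs l k h)"
proof (induction k arbitrary: h)
  case (Suc k)
  have "box_seqs l (Suc k) h = (\<Union>x\<in>{l..h}. (#) x ` box_seqs l k x)" by auto
  then show ?case using Suc by simp
qed simp

lemma length_box_seqs: "c \<in> box_seqs l k h \<Longrightarrow> length c = k"
  by (induction k arbitrary: c h) auto

lemma box_seqs_bound: "c \<in> box_seqs l k h \<Longrightarrow> x \<in> set c \<Longrightarrow> x \<le> h"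
  by (induction k arbitrary: c h) (auto, meson le_trans)

lemma sum_box_seqs:
  fixes q :: "'a::comm_ring_1"
  shows "(\<Sum>c\<in>box_seqs l k (l + r). q ^ (\<Sum>x\<leftarrow>c. l + r - x)) = gauss q k r"
proof (induction k arbitrary: r)
  case 0
  show ?case by simp
next
  case (Suc k)
  note outer = Suc.IH
  show ?case
  proof (induction r)
    case 0
    have "box_seqs l (Suc k) l = (#) l ` box_seqs l k l" by auto
    then show ?case using outer[of 0] by (simp add: sum.reindex)
  next
    case (Suc r)
    let ?h = "l + Suc r"
    have "box_seqs l (Suc k) ?h = (#) ?h ` box_seqs l k ?h \<union> box_seqs l (Suc k) (l + r)"
      by (auto simp: le_Suc_eq)
    moreover have "(#) ?h ` box_seqs l k ?h \<inter> box_seqs l (Suc k) (l + r) = {}" by auto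
    ultimately have "(\<Sum>c\<in>box_seqs l (Suc k) ?h. q ^ (\<Sum>x\<leftarrow>c. ?h - x))
        = (\<Sum>c\<in>box_seqs l k ?h. q ^ (\<Sum>x\<leftarrow>c. ?h - x))
          + (\<Sum>c\<in>box_seqs l (Suc k) (l + r). q ^ (\<Sum>x\<leftarrow>c. ?h - x))"
      by (simp add: sum.union_disjoint sum.reindex del: box_seqs.simps)
    also have "(\<Sum>c\<in>box_seqs l (Suc k) (l + r). q ^ (\<Sum>x\<leftarrow>c. ?h - x))
        = q ^ Suc k * (\<Sum>c\<in>box_seqs l (Suc k) (l + r). q ^ (\<Sum>x\<leftarrow>c. l + r - x))"
      unfolding sum_distrib_left
    proof (rule sum.cong)
      fix c assume c: "c \<in> box_seqs l (Suc k) (l + r)"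
      have "(\<Sum>x\<leftarrow>c. ?h - x) = (\<Sum>x\<leftarrow>c. 1 + (l + r - x))"
        using box_seqs_bound[OF c] by (intro arg_cong[of _ _ sum_list] map_cong) (auto simp: Suc_diff_le)
      also have "\<dots> = Suc k + (\<Sum>x\<leftarrow>c. l + r - x)"
        using length_box_seqs[OF c] by (simp add: sum_list_Suc)
      finally show "q ^ (\<Sum>x\<leftarrow>c. ?h - x) = q ^ Suc k * q ^ (\<Sum>x\<leftarrow>c. l + r - x)"
        by (simp add: power_add)
    qed simp
    also have "(\<Sum>c\<in>box_seqs l k ?h. q ^ (\<Sum>x\<leftarrow>c. ?h - x)) = gauss q k (Suc r)"
      by (rule outer)
    also note Suc.IH
    finally show ?case unfolding gauss_pascal by simp
  qed
qed

lemma append_mem_dyck_seqs_iff: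
  assumes "h \<le> m" "length a = m"
  shows "c @ a \<in> dyck_seqs (length c + m) \<and> head0 (c @ a) \<le> h
     \<longleftrightarrow> a \<in> dyck_seqs m \<and> head0 a \<le> h \<and> c \<in> box_seqs (head0 a) (length c) h"
  using assms(1)
proof (induction c arbitrary: h)
  case (Cons x c)
  show ?case
  proof (cases "x \<le> h")
    case True
    have "head0 (c @ a) \<le> x \<Longrightarrow> head0 a \<le> x" if "c @ a \<in> dyck_seqs (length c + m)"
      using that True Cons by auto
    then show ?thesis using True Cons.IH[of x] Cons.prems by auto
  qed auto
qed simp

text \<open>
  The rows passed by the first run of the bounce path, ending at \<open>(m, m)\<close>, can be chosen
  independently of \<open>a\<close>, within the box allowed by the top entry of \<open>a\<close>.
\<close>
lemma dyck_seqs_first_bounce: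
  assumes "m < n"
  shows "{c \<in> dyck_seqs n. head0 c = m}
     = (\<lambda>(a, b). m # b @ a) ` (SIGMA a:dyck_seqs m. box_seqs (head0 a) (n - m - 1) m)"
    (is "?L = ?R")
proof (intro equalityI subsetI)
  fix c assume "c \<in> ?L"
  then obtain d where c: "c = m # d" and d: "d \<in> dyck_seqs (n - 1)" "head0 d \<le> m"
    using assms by (cases n) auto
  define b where "b = take (n - m - 1) d"
  define a where "a = drop (n - m - 1) d"
  have ab: "d = b @ a" "length a = m" "length b = n - m - 1" "n - 1 = length b + m"
    using assms length_dyck_seqs[OF d(1)] by (auto simp: a_def b_def)
  then have "a \<in> dyck_seqs m" "b \<in> box_seqs (head0 a) (n - m - 1) m"
    using append_mem_dyck_seqs_iff[of m m a b] d by auto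
  then show "c \<in> ?R" unfolding c ab(1) by force
next
  fix c assume "c \<in> ?R"
  then obtain a b where c: "c = m # b @ a" and a: "a \<in> dyck_seqs m"
    and b: "b \<in> box_seqs (head0 a) (n - m - 1) m" by auto
  have "head0 a \<le> m" using a by (cases m) (auto dest: head0_dyck_seqs)
  then have "b @ a \<in> dyck_seqs (n - 1) \<and> head0 (b @ a) \<le> m"
    using append_mem_dyck_seqs_iff[of m m a b] a b length_dyck_seqs[OF a] length_box_seqs[OF b] assms by auto
  then show "c \<in> ?L" unfolding c using assms by (cases n) auto
qed

lemma area_seq_append:
  assumes "\<And>x. x \<in> set b \<Longrightarrow> x \<le> length a"
  shows "area_seq (b @ a) = area_seq a + (length b choose 2) + (\<Sum>x\<leftarrow>b. length a - x)"
  using assms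
proof (induction b)
  case (Cons x b)
  have "length (b @ a) - x = length b + (length a - x)" using Cons.prems[of x] by simp
  moreover have "Suc (length b) choose 2 = length b + (length b choose 2)"
    by (simp add: eval_nat_numeral)
  moreover have "area_seq (b @ a) = area_seq a + (length b choose 2) + (\<Sum>x\<leftarrow>b. length a - x)"
    using Cons by simp
  ultimately show ?case
    by (simp only: append_Cons area_seq.simps list.size list.map sum_list.Cons
        add_Suc_right add_0_right add_Suc add_0_left add_ac)
qed simp

lemma choose_two_add: "(m + k) choose 2 = (m choose 2) + (k choose 2) + m * k"
proof (induction k)
  case (Suc k)
  have 1: "Suc i choose 2 = i + (i choose 2)" for i by (simp add: eval_nat_numeral)
  show ?case using Suc by (simp add: 1)
qed simp

lemma two_choose_two: "2 * (k choose 2) = k * (k - 1)"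
  by (cases k) (simp_all add: choose_two)

text \<open>
  The weight \<open>q\<^bsup>area + (n choose 2)\<^esup> t\<^bsup>bounce\<^esup>\<close>, where \<open>p\<close> stands for \<open>t = 1/q\<close>.
\<close>
definition weight :: "'a::comm_ring_1 \<Rightarrow> 'a \<Rightarrow> nat list \<Rightarrow> 'a" where
  "weight q p c = q ^ (length c choose 2) * q ^ area_seq c * p ^ bounce_seq c"

lemma weight_first_bounce:
  assumes inv: "q * p = (1::'a::comm_ring_1)"
    and a: "a \<in> dyck_seqs m" and b: "b \<in> box_seqs (head0 a) k m"
  shows "weight q p (m # b @ a) = q ^ (k * (m + Suc k)) * q ^ (\<Sum>x\<leftarrow>b. m - x) * weight q p a"
proof -
  have la: "length a = m" and lb: "length b = k"
    using length_dyck_seqs[OF a] length_box_seqs[OF b] by auto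
  have area: "area_seq (m # b @ a) = area_seq a + (Suc k choose 2) + (\<Sum>x\<leftarrow>b. m - x)"
    using area_seq_append[of "m # b" a] box_seqs_bound[OF b] la lb by auto
  have bounce: "bounce_seq (m # b @ a) = m + bounce_seq a" using la lb by simp
  have len: "length (m # b @ a) = m + Suc k" using la lb by simp
  have "(m + Suc k choose 2) + (Suc k choose 2) = m + k * (m + Suc k) + (m choose 2)"
    using choose_two_add[of m "Suc k"] two_choose_two[of "Suc k"] by (simp add: algebra_simps)
  then have "q ^ ((m + Suc k choose 2) + (Suc k choose 2)) * p ^ m
      = q ^ (k * (m + Suc k)) * q ^ (m choose 2) * (q ^ m * p ^ m)"
    by (simp only: power_add mult_ac)
  also have "q ^ m * p ^ m = 1" using inv by (simp flip: power_mult_distrib)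
  finally have exps: "q ^ ((m + Suc k choose 2) + (Suc k choose 2)) * p ^ m
      = q ^ (k * (m + Suc k)) * q ^ (m choose 2)" by simp
  have "weight q p (m # b @ a) = (q ^ ((m + Suc k choose 2) + (Suc k choose 2)) * p ^ m)
      * (q ^ area_seq a * q ^ (\<Sum>x\<leftarrow>b. m - x) * p ^ bounce_seq a)"
    unfolding weight_def area bounce len by (simp only: power_add mult_ac)
  also have "\<dots> = q ^ (k * (m + Suc k)) * q ^ (\<Sum>x\<leftarrow>b. m - x) * weight q p a"
    unfolding exps weight_def la by (simp only: mult_ac)
  finally show ?thesis .
qed

text \<open>
  The factor \<open>gauss q k (m - head0 c)\<close> counts, by area, the ways to put a first bounce run of
  length \<open>k + 1\<close> on top of \<open>c\<close>; it is trivial for \<open>k = 0\<close>.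
\<close>
lemma sum_weight:
  assumes inv: "q * p = (1::'a::comm_ring_1)"
  shows "(\<Sum>c\<in>dyck_seqs m. weight q p c * gauss q k (m - head0 c)) = qballot q m k"
proof (induction m arbitrary: k rule: less_induct)
  case (less m)
  show ?case
  proof (cases "m = 0")
    case True
    then show ?thesis by (simp add: weight_def qballot_def eval_nat_numeral)
  next
    case False
    \<comment> \<open>\<open>r\<close> is the length of the first bounce run; what is left after it is covered by the
      induction hypothesis.\<close>
    have inner: "(\<Sum>c\<in>{c \<in> dyck_seqs m. m - head0 c = r}. weight q p c)
        = q ^ ((r - 1) * m) * qballot q (m - r) (r - 1)"
      if r: "r \<in> {1..m}" for r
    proof -
      have "{c \<in> dyck_seqs m. m - head0 c = r} = {c \<in> dyck_seqs m. head0 c = m - r}"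
        using r head0_dyck_seqs[of _ "m - 1"] False by fastforce
      also have "\<dots> = (\<lambda>(a, b). (m - r) # b @ a) ` (SIGMA a:dyck_seqs (m - r). box_seqs (head0 a) (r - 1) (m - r))"
        using dyck_seqs_first_bounce[of "m - r" m] r by simp
      finally have "(\<Sum>c\<in>{c \<in> dyck_seqs m. m - head0 c = r}. weight q p c)
         = (\<Sum>(a, b)\<in>(SIGMA a:dyck_seqs (m - r). box_seqs (head0 a) (r - 1) (m - r)). weight q p ((m - r) # b @ a))"
        by (simp only:) (subst sum.reindex, auto simp: inj_on_def length_dyck_seqs length_box_seqs case_prod_unfold)
      also have "\<dots> = (\<Sum>a\<in>dyck_seqs (m - r). \<Sum>b\<in>box_seqs (head0 a) (r - 1) (m - r). weight q p ((m - r) # b @ a))"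
        by (simp add: sum.Sigma)
      also have "\<dots> = (\<Sum>a\<in>dyck_seqs (m - r). q ^ ((r - 1) * m) * (weight q p a * gauss q (r - 1) (m - r - head0 a)))"
      proof (rule sum.cong)
        fix a assume a: "a \<in> dyck_seqs (m - r)"
        have t: "head0 a + (m - r - head0 a) = m - r"
          using a head0_dyck_seqs[of a "m - r - 1"] by (cases "m - r") auto
        have "(\<Sum>b\<in>box_seqs (head0 a) (r - 1) (m - r). weight q p ((m - r) # b @ a))
          = (\<Sum>b\<in>box_seqs (head0 a) (r - 1) (m - r).
              q ^ ((r - 1) * m) * (weight q p a * q ^ (\<Sum>x\<leftarrow>b. m - r - x)))"
        proof (rule sum.cong)
          fix b assume "b \<in> box_seqs (head0 a) (r - 1) (m - r)"
          note dec = weight_first_bounce[OF inv a this]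
          have len: "m - r + Suc (r - 1) = m" using r by simp
          show "weight q p ((m - r) # b @ a)
              = q ^ ((r - 1) * m) * (weight q p a * q ^ (\<Sum>x\<leftarrow>b. m - r - x))"
            unfolding dec len by (simp only: mult_ac)
        qed simp
        also have "\<dots> = q ^ ((r - 1) * m) * (weight q p a * gauss q (r - 1) (m - r - head0 a))"
          using sum_box_seqs[where q = q and l = "head0 a" and k = "r - 1" and r = "m - r - head0 a"]
          unfolding t by (simp flip: sum_distrib_left)
        finally show "(\<Sum>b\<in>box_seqs (head0 a) (r - 1) (m - r). weight q p ((m - r) # b @ a))
          = q ^ ((r - 1) * m) * (weight q p a * gauss q (r - 1) (m - r - head0 a))" .
      qed simp
      also have "\<dots> = q ^ ((r - 1) * m) * qballot q (m - r) (r - 1)"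
        using less.IH[of "m - r" "r - 1"] r by (simp flip: sum_distrib_left)
      finally show ?thesis .
    qed
    have img: "(\<lambda>c. m - head0 c) ` dyck_seqs m \<subseteq> {1..m}"
      using head0_dyck_seqs[of _ "m - 1"] False by fastforce
    have "(\<Sum>c\<in>dyck_seqs m. weight q p c * gauss q k (m - head0 c))
        = (\<Sum>r=1..m. \<Sum>c\<in>{c \<in> dyck_seqs m. m - head0 c = r}. weight q p c * gauss q k (m - head0 c))"
      by (rule sum.group[symmetric]) (use img in auto)
    also have "\<dots> = (\<Sum>r=1..m. gauss q k r * (\<Sum>c\<in>{c \<in> dyck_seqs m. m - head0 c = r}. weight q p c))"
      unfolding sum_distrib_left by (intro sum.cong) (auto simp: mult.commute)
    also have "\<dots> = (\<Sum>r=1..m. gauss q k r * (q ^ ((r - 1) * m) * qballot q (m - r) (r - 1)))"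
      using inner by (intro sum.cong) auto
    also have "\<dots> = qballot q m k" using qballot_recurrence[OF inv] False by simp
    finally show ?thesis .
  qed
qed

lemma sum_area_bounce:
  assumes "q * p = (1::'a::comm_ring_1)"
  shows "q ^ (n choose 2) * (\<Sum>c\<in>dyck_seqs n. q ^ area_seq c * p ^ bounce_seq c) = qballot q n 0"
  using sum_weight[OF assms, where m = n and k = 0]
  by (simp add: weight_def length_dyck_seqs sum_distrib_left mult.assoc)

section \<open>Dyck paths as sequences\<close>

text \<open>
  The sequence \<open>a\<^sub>n, \<dots>, a\<^sub>1\<close> of a path.  As the sequences run backwards, so does the argument: it is
  the reversed word of the path.
\<close>
fun profile :: "step list \<Rightarrow> nat list" where
  "profile [] = []"
| "profile (North # w) = count_list w East # profile w"
| "profile (East # w) = profile w"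

text \<open>
  Every suffix has at least as many north as east steps: the Dyck condition for the reversed word.
\<close>
fun ballot_word :: "step list \<Rightarrow> bool" where
  "ballot_word [] = True"
| "ballot_word (s # w) = (ballot_word w \<and> count_list (s # w) East \<le> count_list (s # w) North)"

text \<open>
  The reversed word of the path with a given sequence and \<open>e\<close> east steps in total.
\<close>
primrec path_word :: "nat \<Rightarrow> nat list \<Rightarrow> step list" where
  "path_word e [] = replicate e East"
| "path_word e (x # c) = replicate (e - x) East @ North # path_word x c"

lemma ballot_word_iff: "ballot_word w \<longleftrightarrow> (\<forall>k\<le>length w. count_list (drop k w) East \<le> count_list (drop k w) North)"
proof (induction w)
  case (Cons s w)
  have "(\<forall>k\<le>length (s # w). P k) \<longleftrightarrow> P 0 \<and> (\<forall>k\<le>length w. P (Suc k))" for P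
    by (metis Suc_le_mono le0 length_Cons not0_implies_Suc)
  then show ?case using Cons by auto
qed simp

lemma Dyck_iff: "rev w \<in> Dyck n \<longleftrightarrow> ballot_word w \<and> count_list w North = n \<and> count_list w East = n"
proof -
  have "(\<forall>k\<le>length w. P (length w - k)) \<longleftrightarrow> (\<forall>k\<le>length w. P k)" for P
    by (metis diff_diff_cancel diff_le_self)
  from this[of "\<lambda>k. count_list (drop k w) East \<le> count_list (drop k w) North"]
  show ?thesis unfolding Dyck_def ballot_word_iff by (auto simp: take_rev)
qed

lemma length_profile: "length (profile w) = count_list w North"
  by (induction w rule: profile.induct) auto

lemma head0_profile: "head0 (profile w) \<le> count_list w East"
  by (induction w rule: profile.induct) auto

lemma ballot_word_count: "ballot_word w \<Longrightarrow> count_list w East \<le> count_list w North"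
  by (cases w) auto

lemma profile_dyck_seqs: "ballot_word w \<Longrightarrow> profile w \<in> dyck_seqs (count_list w North)"
  by (induction w rule: profile.induct) (auto simp: head0_profile ballot_word_count)

lemma path_word_profile: "path_word (count_list w East) (profile w) = w"
proof (induction w rule: profile.induct)
  case (3 w)
  then show ?case
    using head0_profile[of w] by (cases "profile w") (auto simp: Suc_diff_le)
qed auto

lemma profile_replicate: "profile (replicate e East @ w) = profile w"
  by (induction e) auto

lemma count_list_replicate: "count_list (replicate e x) y = (if x = y then e else 0)"
  by (induction e) auto

lemma ballot_word_replicate:
  "ballot_word w \<Longrightarrow> e + count_list w East \<le> count_list w North \<Longrightarrow> ballot_word (replicate e East @ w)"
  by (induction e) (auto simp: count_list_replicate)

lemma path_word_correct:
  assumes "c \<in> dyck_seqs n" "head0 c \<le> e" "e \<le> n"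
  shows "ballot_word (path_word e c) \<and> count_list (path_word e c) North = n \<and> count_list (path_word e c) East = e
    \<and> profile (path_word e c) = c"
  using assms
proof (induction n arbitrary: c e)
  case 0
  then show ?case by simp
next
  case (Suc n)
  then obtain x d where c: "c = x # d" "d \<in> dyck_seqs n" "head0 d \<le> x" "x \<le> n" "x \<le> e" by auto
  then show ?case
    using Suc.IH[of d x] Suc.prems(3)
    by (auto simp: profile_replicate count_list_replicate intro!: ballot_word_replicate)
qed

lemma bij_betw_profile: "bij_betw (\<lambda>D. profile (rev D)) (Dyck n) (dyck_seqs n)"
proof (rule bij_betw_byWitness[where f' = "\<lambda>c. rev (path_word n c)"])
  have Dyck: "D \<in> Dyck n \<longleftrightarrow> ballot_word (rev D) \<and> count_list (rev D) North = n \<and> count_list (rev D) East = n"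
    for D using Dyck_iff[of "rev D" n] by simp
  have bound: "head0 c \<le> n" if "c \<in> dyck_seqs n" for c
    using that by (cases n) (auto dest: head0_dyck_seqs)
  show "\<forall>D\<in>Dyck n. rev (path_word n (profile (rev D))) = D"
    using Dyck path_word_profile by (metis rev_rev_ident)
  show "\<forall>c\<in>dyck_seqs n. profile (rev (rev (path_word n c))) = c"
    using path_word_correct bound by auto
  show "(\<lambda>D. profile (rev D)) ` Dyck n \<subseteq> dyck_seqs n"
    using Dyck profile_dyck_seqs by (metis image_subsetI)
  show "(\<lambda>c. rev (path_word n c)) ` dyck_seqs n \<subseteq> Dyck n"
    using Dyck_iff path_word_correct bound by auto
qed

lemma easts_before_profile:
  assumes "1 \<le> y" "y \<le> count_list w North"
  shows "easts_before (rev w) y = rev (profile w) ! (y - 1)"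
  using assms
proof (induction w)
  case Nil
  then show ?case by simp
next
  case (Cons s w)
  let ?F = "\<lambda>D. filter (\<lambda>i. D ! i = North) [0..<length D]"
  have len: "length (?F (rev w)) = count_list w North" for w
  proof (induction w)
    case (Cons s w)
    have "filter (\<lambda>i. (rev w @ [s]) ! i = North) [0..<length w] = ?F (rev w)"
      by (auto intro!: filter_cong simp: nth_append)
    then show ?case using Cons by (auto simp: nth_append)
  qed simp
  have F: "?F (rev (s # w)) = ?F (rev w) @ (if s = North then [length w] else [])"
    by (auto intro!: filter_cong simp: nth_append)
  show ?case
  proof (cases "y \<le> count_list w North")
    case True
    then have y: "y - 1 < length (?F (rev w))" using len[of w] Cons.prems by simp
    then have "?F (rev w) ! (y - 1) \<in> set (?F (rev w))" by (rule nth_mem)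
    then have lt: "north_pos (rev w) y < length w" unfolding north_pos_def by simp
    have eq: "north_pos (rev (s # w)) y = north_pos (rev w) y"
      unfolding north_pos_def F using y by (simp add: nth_append)
    have "easts_before (rev (s # w)) y = easts_before (rev w) y"
      unfolding easts_before_def eq using lt by simp
    moreover have "rev (profile (s # w)) ! (y - 1) = rev (profile w) ! (y - 1)"
      using True Cons.prems by (cases s) (auto simp: nth_append length_profile)
    ultimately show ?thesis using Cons.IH True Cons.prems by simp
  next
    case False
    then have s: "s = North" and y: "y - 1 = count_list w North"
      using Cons.prems by (auto split: if_splits)
    have "north_pos (rev (s # w)) y = length w"
      unfolding north_pos_def F y using len[of w] s by (simp add: nth_append)
    then show ?thesis
      unfolding easts_before_def using s y by (simp add: nth_append length_profile)
  qed
qed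

lemma area_seq_eq: "area_seq c = (\<Sum>y=1..length c. y - 1 - rev c ! (y - 1))"
proof (induction c)
  case (Cons x c)
  have "(\<Sum>y=1..length (x # c). y - 1 - rev (x # c) ! (y - 1))
      = (\<Sum>y=1..length c. y - 1 - rev (x # c) ! (y - 1)) + (length c - x)"
    by (simp add: nth_append)
  also have "(\<Sum>y=1..length c. y - 1 - rev (x # c) ! (y - 1))
      = (\<Sum>y=1..length c. y - 1 - rev c ! (y - 1))"
    by (intro sum.cong) (auto simp: nth_append)
  finally show ?case using Cons by simp
qed simp

lemma bounce_point_Suc:
  "bounce_point j D (Suc i) = bounce_point (if j = 0 then 0 else easts_before D j) D i"
  by (induction i) auto

lemma sum_bounce_point:
  assumes eb: "\<And>y. 1 \<le> y \<Longrightarrow> y \<le> n \<Longrightarrow> easts_before D y = rev c ! (y - 1)"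
    and c: "c \<in> dyck_seqs n"
  shows "j \<le> n \<Longrightarrow> j \<le> N \<Longrightarrow> (\<Sum>i=1..N. bounce_point j D i) = bounce_seq (drop (n - j) c)"
proof (induction j arbitrary: N rule: less_induct)
  case (less j)
  have len: "length c = n" using c by (rule length_dyck_seqs)
  show ?case
  proof (cases "j = 0")
    case True
    have "bounce_point 0 D i = 0" for i by (induction i) auto
    then show ?thesis using True len by simp
  next
    case False
    then obtain M where N: "N = Suc M" using less.prems by (cases N) auto
    define x where "x = easts_before D j"
    have x: "x = rev c ! (j - 1)" unfolding x_def using eb False less.prems by simp
    then have xj: "x \<le> j - 1" using c False less.prems by (simp add: dyck_seqs_iff)
    have "x = c ! (n - j)" unfolding x using len False less.prems by (simp add: rev_nth)
    then have drop: "drop (n - j) c = x # drop (Suc (n - j)) c"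
      using len False less.prems by (simp add: Cons_nth_drop_Suc)
    have "(\<Sum>i=1..N. bounce_point j D i) = (\<Sum>i\<le>M. bounce_point j D (Suc i))"
      unfolding N One_nat_def sum.atLeast_Suc_atMost_Suc_shift atMost_atLeast0
      by (simp add: comp_def del: bounce_point.simps)
    also have "\<dots> = (\<Sum>i\<le>M. bounce_point x D i)"
      unfolding bounce_point_Suc x_def using False by simp
    also have "\<dots> = x + (\<Sum>i=1..M. bounce_point x D i)"
      by (simp add: atMost_atLeast0 sum.atLeast_Suc_atMost)
    also have "(\<Sum>i=1..M. bounce_point x D i) = bounce_seq (drop (n - x) c)"
      using less.IH[of x M] xj False less.prems N by simp
    also have "x + \<dots> = bounce_seq (drop (n - j) c)"
    proof -
      have "length (drop (Suc (n - j)) c) - x + Suc (n - j) = n - x"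
        using len xj False less.prems by simp
      then show ?thesis unfolding drop by simp
    qed
    finally show ?thesis .
  qed
qed

lemma area_bounce_profile:
  assumes "D \<in> Dyck n"
  shows "area n D = area_seq (profile (rev D))" "bounce n D = bounce_seq (profile (rev D))"
proof -
  have c: "profile (rev D) \<in> dyck_seqs n"
    using bij_betw_profile assms by (auto simp: bij_betw_def)
  have "count_list (rev D) North = n" using assms by (simp add: Dyck_def)
  then have eb: "easts_before D y = rev (profile (rev D)) ! (y - 1)" if "1 \<le> y" "y \<le> n" for y
    using easts_before_profile[of y "rev D"] that by simp
  show "area n D = area_seq (profile (rev D))"
    unfolding area_def area_seq_eq length_dyck_seqs[OF c] using eb by (intro sum.cong) auto
  show "bounce n D = bounce_seq (profile (rev D))"
    unfolding bounce_def using sum_bounce_point[OF eb c, of n n] by simp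
qed

lemma sum_Dyck:
  assumes "q * p = (1::'a::comm_ring_1)"
  shows "q ^ (n choose 2) * (\<Sum>D\<in>Dyck n. q ^ area n D * p ^ bounce n D) = qballot q n 0"
proof -
  have "(\<Sum>D\<in>Dyck n. q ^ area n D * p ^ bounce n D)
      = (\<Sum>D\<in>Dyck n. q ^ area_seq (profile (rev D)) * p ^ bounce_seq (profile (rev D)))"
    by (intro sum.cong) (simp_all add: area_bounce_profile)
  also have "\<dots> = (\<Sum>c\<in>dyck_seqs n. q ^ area_seq c * p ^ bounce_seq c)"
    by (rule sum.reindex_bij_betw[OF bij_betw_profile])
  finally show ?thesis using sum_area_bounce[OF assms] by simp
qed

section \<open>231-avoiding permutations as sequences\<close>

text \<open>
  The number of values smaller than all of \<open>\<sigma>\<^sub>y, \<dots>, \<sigma>\<^sub>n\<close>; if a stack sorts a 231-avoiding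
  \<open>\<sigma>\<close> and outputs every value as early as possible, these have left it when \<open>\<sigma>\<^sub>y\<close> is read.
\<close>
definition tail_min :: "nat \<Rightarrow> (nat \<Rightarrow> nat) \<Rightarrow> nat \<Rightarrow> nat" where
  "tail_min n \<sigma> y = Min (\<sigma> ` {y..n}) - 1"

text \<open>
  The values \<open>tail_min n \<sigma> n, \<dots>, tail_min n \<sigma> 1\<close>, in the order used for \<open>dyck_seqs\<close>.
\<close>
definition perm_seq :: "nat \<Rightarrow> (nat \<Rightarrow> nat) \<Rightarrow> nat list" where
  "perm_seq n \<sigma> = rev (map (tail_min n \<sigma>) [1..<Suc n])"

lemma nth_perm_seq: "i < n \<Longrightarrow> rev (perm_seq n \<sigma>) ! i = tail_min n \<sigma> (Suc i)"
  by (simp add: perm_seq_def del: upt_Suc)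

lemma set_perm_seq: "set (perm_seq n \<sigma>) = tail_min n \<sigma> ` {1..n}"
  by (simp add: perm_seq_def atLeastLessThanSuc_atLeastAtMost del: upt_Suc)

lemma length_perm_seq: "length (perm_seq n \<sigma>) = n"
  by (simp add: perm_seq_def)

context
  fixes n :: nat and \<sigma> :: "nat \<Rightarrow> nat"
  assumes perm: "\<sigma> permutes {1..n}"
begin

lemma perm_mem: "y \<in> {1..n} \<Longrightarrow> \<sigma> y \<in> {1..n}"
  using permutes_in_image[OF perm] by blast

lemma perm_inj: "\<sigma> x = \<sigma> y \<longleftrightarrow> x = y"
  using permutes_inj[OF perm] by (auto dest: injD)

lemma inv_mem: "v \<in> {1..n} \<Longrightarrow> inv \<sigma> v \<in> {1..n}"
  using permutes_in_image[OF permutes_inv[OF perm]] by blast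

lemma perm_inv: "\<sigma> (inv \<sigma> v) = v"
  using permutes_inverses(1)[OF perm] .

lemma tail_min_less:
  assumes "1 \<le> y" "y \<le> z" "z \<le> n"
  shows "tail_min n \<sigma> y < \<sigma> z"
proof -
  have "Min (\<sigma> ` {y..n}) \<le> \<sigma> z" using assms by (intro Min_le) auto
  moreover have "\<sigma> z \<ge> 1" using perm_mem[of z] assms by simp
  ultimately show ?thesis unfolding tail_min_def by linarith
qed

lemma tail_min_attained:
  assumes "1 \<le> y" "y \<le> n"
  obtains z where "y \<le> z" "z \<le> n" "\<sigma> z = Suc (tail_min n \<sigma> y)"
proof -
  have "Min (\<sigma> ` {y..n}) \<in> \<sigma> ` {y..n}" using assms by (intro Min_in) auto
  then obtain z where z: "y \<le> z" "z \<le> n" "\<sigma> z = Min (\<sigma> ` {y..n})" by auto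
  moreover have "\<sigma> z \<ge> 1" using perm_mem[of z] assms z by simp
  ultimately have "\<sigma> z = Suc (tail_min n \<sigma> y)" unfolding tail_min_def by linarith
  then show ?thesis using that z by blast
qed

lemma tail_min_mono:
  assumes "1 \<le> y" "y \<le> z" "z \<le> n"
  shows "tail_min n \<sigma> y \<le> tail_min n \<sigma> z"
proof -
  obtain x where "z \<le> x" "x \<le> n" "\<sigma> x = Suc (tail_min n \<sigma> z)"
    using tail_min_attained[of z] assms by auto
  then show ?thesis using tail_min_less[of y x] assms by simp
qed

lemma tail_min_bound:
  assumes "1 \<le> y" "y \<le> n"
  shows "tail_min n \<sigma> y < y"
proof -
  have "\<sigma> ` {y..n} \<subseteq> {Suc (tail_min n \<sigma> y)..n}"
  proof (rule image_subsetI)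
    fix z assume "z \<in> {y..n}"
    then show "\<sigma> z \<in> {Suc (tail_min n \<sigma> y)..n}"
      using tail_min_less[of y z] perm_mem[of z] assms by simp
  qed
  then have "card (\<sigma> ` {y..n}) \<le> card {Suc (tail_min n \<sigma> y)..n}"
    by (intro card_mono) auto
  moreover have "card (\<sigma> ` {y..n}) = card {y..n}"
    by (intro card_image inj_onI) (simp add: perm_inj)
  ultimately show ?thesis using assms by simp
qed

lemma perm_seq_dyck_seqs: "perm_seq n \<sigma> \<in> dyck_seqs n"
proof -
  have "tail_min n \<sigma> (Suc i) \<le> tail_min n \<sigma> (Suc j)" if "i \<le> j" "j < n" for i j
    using that by (intro tail_min_mono) auto
  moreover have "tail_min n \<sigma> (Suc i) \<le> i" if "i < n" for i
    using tail_min_bound[of "Suc i"] that by simp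
  ultimately show ?thesis
    by (simp add: dyck_seqs_iff sorted_iff_nth_mono nth_perm_seq length_perm_seq)
qed

context
  assumes avoid: "avoids_231 n \<sigma>"
begin

lemma no_231:
  assumes "1 \<le> i" "i < j" "j < k" "k \<le> n" "\<sigma> k < \<sigma> i" "\<sigma> i < \<sigma> j"
  shows False
  using avoid assms unfolding avoids_231_def by blast

text \<open>
  The value \<open>v\<close> stands at the last position \<open>y\<close> with \<open>tail_min n \<sigma> y < v\<close> not occupied by a
  smaller value: such a \<open>y\<close> to the right of \<open>v\<close> would carry a larger value, and some value after \<open>y\<close>
  would be smaller than \<open>v\<close>: a pattern 231.
\<close>
lemma inv_greedy:
  assumes v: "v \<in> {1..n}"
  shows "inv \<sigma> v = Max ({y \<in> {1..n}. tail_min n \<sigma> y < v} - inv \<sigma> ` {1..<v})"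
proof (rule Max_eqI[symmetric])
  let ?p = "inv \<sigma> v"
  have p: "?p \<in> {1..n}" using inv_mem v by blast
  show "?p \<in> {y \<in> {1..n}. tail_min n \<sigma> y < v} - inv \<sigma> ` {1..<v}"
  proof (intro DiffI CollectI conjI)
    show "tail_min n \<sigma> ?p < v" using p tail_min_less[of ?p ?p] perm_inv[of v] by simp
    show "?p \<notin> inv \<sigma> ` {1..<v}"
    proof
      assume "?p \<in> inv \<sigma> ` {1..<v}"
      then obtain u where u: "u < v" "?p = inv \<sigma> u" by auto
      from u(2) have "\<sigma> ?p = \<sigma> (inv \<sigma> u)" by simp
      then show False using u(1) by (simp only: perm_inv)
    qed
  qed (rule p)
  fix y assume y: "y \<in> {y \<in> {1..n}. tail_min n \<sigma> y < v} - inv \<sigma> ` {1..<v}"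
  have "\<sigma> y \<ge> v"
  proof (rule ccontr)
    assume "\<not> \<sigma> y \<ge> v"
    then have "inv \<sigma> (\<sigma> y) \<in> inv \<sigma> ` {1..<v}" using y perm_mem[of y] by (intro imageI) auto
    then show False using y permutes_inverses(2)[OF perm] by simp
  qed
  show "y \<le> ?p"
  proof (rule ccontr)
    assume "\<not> y \<le> ?p"
    then have py: "?p < y" by simp
    then have vy: "v < \<sigma> y" using \<open>\<sigma> y \<ge> v\<close> perm_inj[of y ?p] perm_inv[of v] by simp
    obtain z where z: "y \<le> z" "z \<le> n" "\<sigma> z = Suc (tail_min n \<sigma> y)"
      using tail_min_attained[of y] y by auto
    have "\<sigma> z \<le> v" using z y by simp
    moreover have "\<sigma> z \<noteq> v" using py z(1) perm_inj[of z ?p] perm_inv[of v] by auto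
    ultimately have "\<sigma> z < v" by simp
    then have "y \<noteq> z" using vy by auto
    then have "y < z" using z(1) by simp
    then show False using no_231[of ?p y z] p py z vy \<open>\<sigma> z < v\<close> perm_inv by simp
  qed
qed simp

lemma Des_iff:
  assumes "1 \<le> i" "i < n"
  shows "\<sigma> i > \<sigma> (i + 1) \<longleftrightarrow> tail_min n \<sigma> i = tail_min n \<sigma> (i + 1)"
proof
  assume gt: "\<sigma> i > \<sigma> (i + 1)"
  obtain z where z: "i \<le> z" "z \<le> n" "\<sigma> z = Suc (tail_min n \<sigma> i)"
    using tail_min_attained[of i] assms by auto
  have "z \<noteq> i"
    using tail_min_less[of i "i + 1"] assms gt z by auto
  then have "tail_min n \<sigma> (i + 1) < \<sigma> z" using z assms by (intro tail_min_less) auto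
  then show "tail_min n \<sigma> i = tail_min n \<sigma> (i + 1)"
    using z tail_min_mono[of i "i + 1"] assms by simp
next
  assume eq: "tail_min n \<sigma> i = tail_min n \<sigma> (i + 1)"
  obtain z where z: "i + 1 \<le> z" "z \<le> n" "\<sigma> z = Suc (tail_min n \<sigma> (i + 1))"
    using tail_min_attained[of "i + 1"] assms by auto
  have "\<sigma> i \<noteq> \<sigma> z" "\<sigma> i \<noteq> \<sigma> (i + 1)"
    using z(1) perm_inj[of i z] perm_inj[of i "i + 1"] by auto
  moreover have "\<sigma> z \<le> \<sigma> i" using tail_min_less[of i i] eq z assms by simp
  ultimately have zi: "\<sigma> z < \<sigma> i" "\<sigma> i \<noteq> \<sigma> (i + 1)" by auto
  show "\<sigma> i > \<sigma> (i + 1)"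
  proof (rule ccontr)
    assume "\<not> \<sigma> i > \<sigma> (i + 1)"
    then have lt: "\<sigma> i < \<sigma> (i + 1)" using zi by simp
    then have "z \<noteq> i + 1" using zi by auto
    then show False using no_231[of i "i + 1" z] z zi lt assms by simp
  qed
qed

lemma inverse_Des_iff:
  assumes "1 \<le> j" "j < n"
  shows "inv \<sigma> j > inv \<sigma> (j + 1) \<longleftrightarrow> j \<notin> tail_min n \<sigma> ` {1..n}"
proof -
  let ?p = "inv \<sigma> j" and ?r = "inv \<sigma> (j + 1)"
  have p: "?p \<in> {1..n}" and r: "?r \<in> {1..n}" using inv_mem[of j] inv_mem[of "j + 1"] assms by auto
  have ne: "?p \<noteq> ?r" using perm_inv[of j] perm_inv[of "j + 1"] by auto
  have "?p < ?r \<longleftrightarrow> j \<in> tail_min n \<sigma> ` {1..n}"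
  proof
    assume "j \<in> tail_min n \<sigma> ` {1..n}"
    then obtain y where y: "1 \<le> y" "y \<le> n" "tail_min n \<sigma> y = j" by auto
    obtain z where z: "y \<le> z" "z \<le> n" "\<sigma> z = j + 1"
      using tail_min_attained[of y] y by auto
    have "z = ?r" using z perm_inj[of z ?r] perm_inv[of "j + 1"] by simp
    moreover have "?p < y" using tail_min_less[of y ?p] y p perm_inv[of j] by (cases "?p < y") auto
    ultimately show "?p < ?r" using z by simp
  next
    assume lt: "?p < ?r"
    obtain z where z: "?r \<le> z" "z \<le> n" "\<sigma> z = Suc (tail_min n \<sigma> ?r)"
      using tail_min_attained[of ?r] r by auto
    have "tail_min n \<sigma> ?r \<le> j" using tail_min_less[of ?r ?r] r perm_inv[of "j + 1"] by simp
    moreover have "\<not> tail_min n \<sigma> ?r < j"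
    proof
      assume "tail_min n \<sigma> ?r < j"
      then have le: "\<sigma> z \<le> j" using z by simp
      have "z \<noteq> ?p" "z \<noteq> ?r" using z lt le perm_inv[of "j + 1"] by auto
      then have "\<sigma> z < j" "?r < z"
        using le z perm_inj[of z ?p] perm_inv[of j] by auto
      then show False
        using no_231[of ?p ?r z] p lt z perm_inv[of j] perm_inv[of "j + 1"] by simp
    qed
    ultimately have "tail_min n \<sigma> ?r = j" by simp
    then show "j \<in> tail_min n \<sigma> ` {1..n}" using r by (intro image_eqI) auto
  qed
  then show ?thesis using ne by auto
qed

end

end

text \<open>
  The major index splits into the positions of the ascents of the sequence and its nonzero values,
  each of which is entered by exactly one ascent.
\<close>
lemma valley_maj_eq:
  assumes "c \<in> dyck_seqs n"
  shows "valley_maj c = \<Sum>{i \<in> {1..<n}. rev c ! (i - 1) < rev c ! i} + \<Sum>(set c - {0})"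
  using assms
proof (induction n arbitrary: c)
  case 0
  then show ?case by simp
next
  case (Suc n)
  then obtain x d where c: "c = x # d" "d \<in> dyck_seqs n" "head0 d \<le> x" "x \<le> n" by auto
  have len: "length d = n" using c by (simp add: length_dyck_seqs)
  have last: "n > 0 \<Longrightarrow> rev d ! (n - 1) = head0 d"
    using len by (cases d) (auto simp: nth_append)
  have "sorted (rev d)" using c by (simp add: dyck_seqs_iff)
  then have max: "y \<in> set d \<Longrightarrow> y \<le> head0 d" for y
    by (cases d) (auto simp: sorted_append)
  have mem: "n > 0 \<Longrightarrow> head0 d \<in> set d" using len by (cases d) auto
  have asc: "{i \<in> {1..<Suc n}. rev c ! (i - 1) < rev c ! i}
      = {i \<in> {1..<n}. rev d ! (i - 1) < rev d ! i} \<union> (if n > 0 \<and> head0 d < x then {n} else {})"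
  proof (rule set_eqI)
    fix i
    have "rev c ! k = (if k < n then rev d ! k else x)" if "k \<le> n" for k
      using that len by (auto simp: c(1) nth_append)
    then show "i \<in> {i \<in> {1..<Suc n}. rev c ! (i - 1) < rev c ! i} \<longleftrightarrow>
      i \<in> {i \<in> {1..<n}. rev d ! (i - 1) < rev d ! i} \<union> (if n > 0 \<and> head0 d < x then {n} else {})"
      using last by (cases i n rule: linorder_cases) auto
  qed
  have vals: "set c - {0} = (set d - {0}) \<union> (if n > 0 \<and> head0 d < x then {x} else {})"
    using c mem by (cases "n = 0") (auto simp: le_less)
  show ?case
  proof (cases "n > 0 \<and> head0 d < x")
    case True
    then have "x \<notin> set d" using max by fastforce
    then show ?thesis
      unfolding asc vals using True Suc.IH[OF c(2)] by (simp add: c(1) len)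
  next
    case False
    then have "\<not> head0 d < x" using c by auto
    then show ?thesis
      unfolding asc vals using False Suc.IH[OF c(2)] by (simp add: c(1))
  qed
qed

lemma sum_1_upto: "\<Sum>{1..<n} = n choose 2"
  by (induction n) (auto simp: eval_nat_numeral atLeastLessThanSuc)

lemma imaj_le: "imaj n \<sigma> \<le> n choose 2"
  unfolding imaj_def maj_def Des_def sum_1_upto[symmetric] by (intro sum_mono2) auto

lemma maj_imaj_valley_maj:
  assumes "\<sigma> \<in> S_231 n"
  shows "maj n \<sigma> + imaj n \<sigma> + valley_maj (perm_seq n \<sigma>) = 2 * (n choose 2)"
proof -
  have perm: "\<sigma> permutes {1..n}" and avoid: "avoids_231 n \<sigma>" using assms by (auto simp: S_231_def)
  note mono = tail_min_mono[OF perm] and bound = tail_min_bound[OF perm]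
  define R where "R = {i \<in> {1..<n}. rev (perm_seq n \<sigma>) ! (i - 1) < rev (perm_seq n \<sigma>) ! i}"
  define V where "V = set (perm_seq n \<sigma>) - {0}"
  have "Des n \<sigma> = {1..<n} - R"
  proof -
    have "\<sigma> i > \<sigma> (i + 1) \<longleftrightarrow> \<not> rev (perm_seq n \<sigma>) ! (i - 1) < rev (perm_seq n \<sigma>) ! i"
      if "i \<in> {1..<n}" for i
      using Des_iff[OF perm avoid, of i] mono[of i "i + 1"] that
      by (auto simp: nth_perm_seq)
    then show ?thesis unfolding Des_def R_def by auto
  qed
  moreover have "R \<subseteq> {1..<n}" by (auto simp: R_def)
  ultimately have 1: "maj n \<sigma> + \<Sum>R = n choose 2"
    unfolding maj_def sum_1_upto[symmetric] by (metis finite_atLeastLessThan sum.subset_diff)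
  have sub: "V \<subseteq> {1..<n}"
    using bound by (fastforce simp: V_def set_perm_seq)
  have "Des n (inv \<sigma>) = {1..<n} - V"
    using inverse_Des_iff[OF perm avoid] unfolding Des_def V_def set_perm_seq by auto
  with sub have 2: "imaj n \<sigma> + \<Sum>V = n choose 2"
    unfolding imaj_def maj_def sum_1_upto[symmetric] by (metis finite_atLeastLessThan sum.subset_diff)
  show ?thesis
    using 1 2 valley_maj_eq[OF perm_seq_dyck_seqs[OF perm]] unfolding R_def V_def by simp
qed

lemma inj_on_perm_seq: "inj_on (perm_seq n) (S_231 n)"
proof (rule inj_onI)
  fix \<sigma> \<tau> assume \<sigma>: "\<sigma> \<in> S_231 n" and \<tau>: "\<tau> \<in> S_231 n" and eq: "perm_seq n \<sigma> = perm_seq n \<tau>"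
  have s: "\<sigma> permutes {1..n}" "avoids_231 n \<sigma>" and t: "\<tau> permutes {1..n}" "avoids_231 n \<tau>"
    using \<sigma> \<tau> by (auto simp: S_231_def)
  have tm: "tail_min n \<sigma> y = tail_min n \<tau> y" if "y \<in> {1..n}" for y
    using nth_perm_seq[of "y - 1" n \<sigma>] nth_perm_seq[of "y - 1" n \<tau>] eq that
    by (auto simp: Suc_diff_le)
  have in_range: "v \<in> {1..n} \<Longrightarrow> inv \<sigma> v = inv \<tau> v" for v
  proof (induction v rule: less_induct)
    case (less v)
    have "{y \<in> {1..n}. tail_min n \<sigma> y < v} = {y \<in> {1..n}. tail_min n \<tau> y < v}" using tm by auto
    moreover have "inv \<sigma> ` {1..<v} = inv \<tau> ` {1..<v}"
      using less by (intro image_cong) auto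
    ultimately show ?case
      using inv_greedy[OF s less.prems] inv_greedy[OF t less.prems] by simp
  qed
  have "inv \<sigma> v = inv \<tau> v" for v
    using in_range permutes_not_in[OF permutes_inv[OF s(1)], of v]
      permutes_not_in[OF permutes_inv[OF t(1)], of v] by (cases "v \<in> {1..n}") auto
  then show "\<sigma> = \<tau>" using permutes_inv_inv[OF s(1)] permutes_inv_inv[OF t(1)] by (metis ext)
qed

text \<open>
  The position of the value \<open>v\<close> in the permutation rebuilt from the sequence \<open>c\<close>: the last position
  \<open>y\<close> with \<open>c y < v\<close> that no smaller value occupies, as in \<open>inv_greedy\<close>.
\<close>
function greedy_place :: "nat \<Rightarrow> (nat \<Rightarrow> nat) \<Rightarrow> nat \<Rightarrow> nat" where
  "greedy_place n c v = Max ({y \<in> {1..n}. c y < v} - greedy_place n c ` {1..<v})"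
  by auto
termination by (relation "measure (\<lambda>(n, c, v). v)") auto

declare greedy_place.simps [simp del]

lemma perm_seq_surj:
  assumes "l \<in> dyck_seqs n"
  obtains \<sigma> where "\<sigma> \<in> S_231 n" "perm_seq n \<sigma> = l"
proof -
  define c where "c y = rev l ! (y - 1)" for y
  have len: "length l = n" using assms by (rule length_dyck_seqs)
  have less: "c y < y" if "y \<in> {1..n}" for y
    using that assms unfolding c_def dyck_seqs_iff by (auto dest!: spec[of _ "y - 1"])
  have mono: "c y \<le> c z" if "1 \<le> y" "y \<le> z" "z \<le> n" for y z
    using that assms len unfolding c_def dyck_seqs_iff sorted_iff_nth_mono by simp
  let ?A = "\<lambda>v. {y \<in> {1..n}. c y < v} - greedy_place n c ` {1..<v}"
  \<comment> \<open>All of \<open>1, \<dots>, v\<close> are admissible positions for \<open>v\<close>, and only \<open>v - 1\<close> are taken.\<close>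
  have ne: "?A v \<noteq> {}" if "v \<in> {1..n}" for v
  proof
    assume "?A v = {}"
    moreover have "{1..v} \<subseteq> {y \<in> {1..n}. c y < v}"
      using less that by (fastforce intro: less_le_trans)
    ultimately have "{1..v} \<subseteq> greedy_place n c ` {1..<v}" by blast
    then have "card {1..v} \<le> card (greedy_place n c ` {1..<v})" by (intro card_mono) auto
    also have "\<dots> \<le> card {1..<v}" by (rule card_image_le) simp
    finally show False using that by (cases v) auto
  qed
  have mem: "greedy_place n c v \<in> ?A v" if "v \<in> {1..n}" for v
    using Max_in[OF _ ne[OF that]] by (simp add: greedy_place.simps[of n c v])
  have ge: "y \<le> greedy_place n c v" if "y \<in> ?A v" for v y
    using that unfolding greedy_place.simps[of n c v] by (intro Max_ge) auto
  have inj: "inj_on (greedy_place n c) {1..n}"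
  proof (rule linorder_inj_onI')
    fix u v assume uv: "u \<in> {1..n}" "v \<in> {1..n}" "u < v"
    then have "greedy_place n c u \<in> greedy_place n c ` {1..<v}" by (intro imageI) auto
    then show "greedy_place n c u \<noteq> greedy_place n c v" using mem[OF uv(2)] by (metis DiffD2)
  qed
  have "greedy_place n c ` {1..n} \<subseteq> {1..n}" using mem by auto
  then have "bij_betw (greedy_place n c) {1..n} {1..n}"
    using inj by (simp add: bij_betw_def endo_inj_surj)
  define \<pi> where "\<pi> v = (if v \<in> {1..n} then greedy_place n c v else v)" for v
  have "bij_betw \<pi> {1..n} {1..n}"
    using \<open>bij_betw (greedy_place n c) {1..n} {1..n}\<close> by (rule bij_betw_cong[THEN iffD1, rotated]) (simp add: \<pi>_def)
  then have \<pi>: "\<pi> permutes {1..n}" by (rule bij_imp_permutes) (auto simp: \<pi>_def)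
  define \<sigma> where "\<sigma> = inv \<pi>"
  have \<sigma>: "\<sigma> permutes {1..n}" unfolding \<sigma>_def using \<pi> by (rule permutes_inv)
  have \<sigma>_mem: "\<sigma> y \<in> {1..n}" if "y \<in> {1..n}" for y
    using that permutes_in_image[OF \<sigma>] by blast
  have place_\<sigma>: "greedy_place n c (\<sigma> y) = y" if "y \<in> {1..n}" for y
    using permutes_inverses(1)[OF \<pi>, of y] \<sigma>_mem[OF that] by (simp add: \<sigma>_def \<pi>_def)
  have c\<sigma>: "c y < \<sigma> y" if "y \<in> {1..n}" for y
    using mem[OF \<sigma>_mem[OF that]] place_\<sigma>[OF that] by simp
  have free: "y \<in> ?A v" if "y \<in> {1..n}" "c y < v" "v \<le> \<sigma> y" for y v
  proof -
    have "y \<notin> greedy_place n c ` {1..<v}"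
    proof
      assume "y \<in> greedy_place n c ` {1..<v}"
      then obtain u where u: "u \<in> {1..<v}" "y = greedy_place n c u" by blast
      have "u \<in> {1..n}" using u(1) that(3) \<sigma>_mem[OF that(1)] by auto
      moreover have "greedy_place n c u = greedy_place n c (\<sigma> y)" using u(2) place_\<sigma>[OF that(1)] by simp
      ultimately have "u = \<sigma> y" using \<sigma>_mem[OF that(1)] inj by (auto dest: inj_onD)
      then show False using u(1) that(3) by simp
    qed
    then show ?thesis using that(1,2) by blast
  qed
  have "avoids_231 n \<sigma>"
    unfolding avoids_231_def
  proof (clarify)
    fix i j k assume ijk: "1 \<le> i" "i < j" "j < k" "k \<le> n" and lt: "\<sigma> k < \<sigma> i" "\<sigma> i < \<sigma> j"
    have "c j < \<sigma> i" using mono[of j k] c\<sigma>[of k] ijk lt by simp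
    then have "j \<le> greedy_place n c (\<sigma> i)" using free[of j "\<sigma> i"] ge ijk lt by simp
    then show False using place_\<sigma>[of i] ijk by simp
  qed
  have tm: "tail_min n \<sigma> y = c y" if y: "y \<in> {1..n}" for y
  proof -
    have "Min (\<sigma> ` {y..n}) = Suc (c y)"
    proof (rule Min_eqI)
      fix v assume "v \<in> \<sigma> ` {y..n}"
      then obtain z where z: "y \<le> z" "z \<le> n" "v = \<sigma> z" by auto
      then show "Suc (c y) \<le> v" using mono[of y z] c\<sigma>[of z] y by simp
    next
      have v: "Suc (c y) \<in> {1..n}" using less[OF y] y by auto
      have "y \<le> greedy_place n c (Suc (c y))" using free[of y "Suc (c y)"] ge c\<sigma>[OF y] y by simp
      moreover have "greedy_place n c (Suc (c y)) \<le> n" using mem[OF v] by simp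
      moreover have "\<sigma> (greedy_place n c (Suc (c y))) = Suc (c y)"
        using permutes_inverses(2)[OF \<pi>, of "Suc (c y)"] v by (simp add: \<sigma>_def \<pi>_def)
      ultimately show "Suc (c y) \<in> \<sigma> ` {y..n}" by (metis atLeastAtMost_iff image_eqI)
    qed simp
    then show ?thesis by (simp add: tail_min_def)
  qed
  have "rev (perm_seq n \<sigma>) = rev l"
    by (rule nth_equalityI) (auto simp: length_perm_seq len nth_perm_seq tm c_def)
  then have "perm_seq n \<sigma> = l" by simp
  moreover have "\<sigma> \<in> S_231 n" using \<sigma> \<open>avoids_231 n \<sigma>\<close> by (simp add: S_231_def)
  ultimately show ?thesis by (rule that[rotated])
qed

lemma bij_betw_perm_seq: "bij_betw (perm_seq n) (S_231 n) (dyck_seqs n)"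
  unfolding bij_betw_def
proof (intro conjI inj_on_perm_seq equalityI subsetI)
  fix l assume "l \<in> dyck_seqs n"
  then show "l \<in> perm_seq n ` S_231 n" by (metis perm_seq_surj image_eqI)
qed (auto simp: S_231_def perm_seq_dyck_seqs)

text \<open>
  The exponent of \<open>q\<close> at \<open>t = 1/q\<close> is \<open>maj + imaj - N = N - M\<close>.
\<close>
lemma sum_S_231:
  assumes inv: "q * p = (1::'a::comm_ring_1)"
  shows "(\<Sum>\<sigma>\<in>S_231 n. q ^ maj n \<sigma> * p ^ ((n choose 2) - imaj n \<sigma>)) = q ^ (n choose 2) * qballot p n 0"
proof -
  have qp: "q ^ k * p ^ k = 1" for k using inv by (simp flip: power_mult_distrib)
  have "q ^ maj n \<sigma> * p ^ ((n choose 2) - imaj n \<sigma>) = q ^ (n choose 2) * p ^ valley_maj (perm_seq n \<sigma>)"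
    if \<sigma>: "\<sigma> \<in> S_231 n" for \<sigma>
  proof -
    define C where "C = n choose 2"
    define d where "d = C - imaj n \<sigma>"
    have "maj n \<sigma> + valley_maj (perm_seq n \<sigma>) = C + d"
      using maj_imaj_valley_maj[OF \<sigma>] imaj_le[of n \<sigma>] by (simp add: C_def d_def)
    then have "q ^ maj n \<sigma> * q ^ valley_maj (perm_seq n \<sigma>) = q ^ C * q ^ d"
      by (simp flip: power_add)
    then have "q ^ maj n \<sigma> * p ^ d * (q ^ valley_maj (perm_seq n \<sigma>) * p ^ valley_maj (perm_seq n \<sigma>))
        = q ^ C * p ^ valley_maj (perm_seq n \<sigma>) * (q ^ d * p ^ d)"
      by (metis (no_types, lifting) mult.assoc mult.commute)
    then show ?thesis unfolding qp by (simp add: C_def d_def)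
  qed
  then have "(\<Sum>\<sigma>\<in>S_231 n. q ^ maj n \<sigma> * p ^ ((n choose 2) - imaj n \<sigma>))
      = (\<Sum>\<sigma>\<in>S_231 n. q ^ (n choose 2) * p ^ valley_maj (perm_seq n \<sigma>))"
    by (intro sum.cong) auto
  also have "\<dots> = q ^ (n choose 2) * (\<Sum>c\<in>dyck_seqs n. p ^ valley_maj c)"
    unfolding sum_distrib_left
    by (rule sum.reindex_bij_betw[OF bij_betw_perm_seq])
  finally show ?thesis unfolding sum_valley_maj .
qed

section \<open>Specialising the two polynomials\<close>

lemma map_poly_sum:
  assumes "f 0 = 0" "\<And>a b. f (a + b) = f a + f b"
  shows "map_poly f (\<Sum>x\<in>A. g x) = (\<Sum>x\<in>A. map_poly f (g x))"
proof (induction A rule: infinite_finite_induct)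
  case (insert x A)
  have "map_poly f (u + v) = map_poly f u + map_poly f v" for u v
    by (rule poly_eqI) (simp add: coeff_map_poly assms)
  then show ?case using insert by simp
qed simp_all

lemma qt_eval_sum_monom:
  "qt_eval (\<Sum>x\<in>A. qt_monom (f x) (g x)) q t = (\<Sum>x\<in>A. q ^ f x * t ^ g x)"
proof -
  let ?h = "\<lambda>p. poly (map_poly of_int p) q"
  have add: "?h (u + v) = ?h u + ?h v" for u v
  proof -
    have "map_poly of_int (u + v) = map_poly of_int u + (map_poly of_int v :: 'a poly)"
      by (rule poly_eqI) (simp add: coeff_map_poly)
    then show ?thesis by simp
  qed
  show ?thesis
    unfolding qt_eval_def qt_monom_def
    by (subst map_poly_sum) (simp_all add: add poly_sum map_poly_monom poly_monom)
qed

theorem mainTheorem5: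
  fixes n :: nat
  assumes "n \<ge> 1"
  shows "qt_eval (A_poly n) (fls_X :: int fls) fls_X_inv
       = qt_eval (Cat_poly n) (fls_X :: int fls) fls_X_inv"
proof -
  let ?q = "fls_X :: int fls" and ?p = "fls_X_inv :: int fls"
  let ?C = "n choose 2"
  let ?A = "qt_eval (A_poly n) ?q ?p" and ?B = "qt_eval (Cat_poly n) ?q ?p"
  have inv: "?q * ?p = 1" "?p * ?q = 1"
    by (simp_all add: fls_X_inv_times_conv_shift fls_X_conv_shift_1)
  have "?A = ?q ^ ?C * qballot ?p n 0"
    unfolding A_poly_def qt_eval_sum_monom by (rule sum_S_231[OF inv(1)])
  then have "?q ^ ?C * ?A = ?q ^ (n * (n - 1)) * qballot ?p n 0"
    unfolding two_choose_two[symmetric] mult_2 power_add by (simp only: mult.assoc)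
  also have "\<dots> = qballot ?q n 0" by (rule qballot_inverse[OF inv(1)])
  also have "\<dots> = ?q ^ ?C * ?B"
    unfolding Cat_poly_def qt_eval_sum_monom by (rule sum_Dyck[OF inv(1), symmetric])
  finally have "?p ^ ?C * ?q ^ ?C * ?A = ?p ^ ?C * ?q ^ ?C * ?B" by (simp only: mult.assoc)
  moreover have "?p ^ ?C * ?q ^ ?C = 1" using inv(2) by (simp only: power_mult_distrib[symmetric] power_one)
  ultimately show ?thesis by simp
qed

end
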